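(* Let $C\ell_{p,q,r}$, $p+q+r=n$, be a geometric algebra with $r\neq0$. Then $$\Big(\big(\Lambda^{(0)}_r\big)^{\perp}_{Z_{p,q,r}}\Big)^2=\{0\}\quad\text{if } n \text{ is odd};$$ $$\Big(\big(\Lambda^{(0)}_r\big)^{\perp}_{Z^{3}_{p,q,r}}\Big)^2=\{0\}\quad\text{if } n=4 \text{ or } n\ge6;$$ $$\Big(\big(\Lambda^{(0)}_{r}\big)^{\perp}_{\check Z^2_{p,q,r}\cap\check Z^3_{p,q,r}}\Big)^2=\Big(\big(\Lambda^{(0)}_{r}\big)^{\perp}_{\check Z^1_{p,q,r}\cap\check Z^2_{p,q,r}}\Big)^2=\{0\}\quad\text{if } n\ge3;$$ $$\Big(\big(\Lambda^{(0)}_{r}\big)^{\perp}_{Z^2_{p,q,r}\cap Z^3_{p,q,r}}\Big)^2=\Big(\big(\Lambda^{(0)}_{r}\big)^{\perp}_{Z^3_{p,q,r}\cap C\ell^{(0)}_{p,q,r}}\Big)^2=\{0\}\quad\text{if } n\ge4.$$ Here, for a subspace $S$ of $C\ell_{p,q,r}$, the equality $S^2=\{0\}$ means that $XY=0$ for all $X,Y\in S$.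
   Context: $C\ell_{p,q,r}$, $p+q+r=n\ge1$, is the Clifford (geometric) algebra over the real space $\mathbb{R}^{p,q,r}$ or the complex space $\mathbb{C}^{p+q,0,r}$ (field $\mathbb{F}=\mathbb{R}$ or $\mathbb{C}$ respectively), with identity $e$ and generators $e_1,\dots,e_n$ satisfying $e_ae_b+e_be_a=2\eta_{ab}e$, where $\eta$ is diagonal with $p$ entries $+1$, then $q$ entries $-1$, then $r$ entries $0$ (in the complex case, $p+q$ entries $+1$ and $r$ entries $0$). $C\ell^k_{p,q,r}$ is the grade-$k$ subspace, spanned by the basis elements $e_{a_1}\cdots e_{a_k}$, $a_1<\dots<a_k$ (it is $\{0\}$ for $k<0$ or $k>n$). $\Lambda_r=C\ell_{0,0,r}$ is the Grassmann subalgebra generated by the $r$ null generators $e_{p+q+1},\dots,e_n$. $\widehat U$ is the grade involution (multiplication by $(-1)^k$ on grade $k$). $C\ell^{(0)}_{p,q,r}$ is the even subspace and $\Lambda^{(0)}_r=\Lambda_r\cap C\ell^{(0)}_{p,q,r}$. $Z_{p,q,r}$ is the center of $C\ell_{p,q,r}$; $Z^m_{p,q,r}=\{X\in C\ell_{p,q,r}:\ XV=VX\ \ \forall V\in C\ell^m_{p,q,r}\}$; $\check Z^m_{p,q,r}=\{X\in C\ell_{p,q,r}:\ \widehat XV=VX\ \ \forall V\in C\ell^m_{p,q,r}\}$. For $D\subseteq H\subseteq C\ell_{p,q,r}$ with $D$ spanned by basis elements, $D^{\perp}_H=\{X\in H:\ \langle X\rangle_D=0\}$, where $\langle X\rangle_D$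 is the projection of $X$ onto $D$ (keeping only the basis elements belonging to $D$). *)

theory Defs
  imports Complex_Main "HOL-Library.Function_Algebras"
begin

section \<open>Multivectors\<close>

text \<open>
  A multivector is given by its coordinates: \<open>X A\<close> is the coefficient of the basis element
  \<open>e\<^sub>A = e\<^sub>a\<^sub>1 \<cdots> e\<^sub>a\<^sub>k\<close>, where \<open>A = {a\<^sub>1 < \<dots> < a\<^sub>k}\<close>. Addition and zero are those of
  \<open>Function_Algebras\<close>; the pointwise product \<open>*\<close> of functions is never used on multivectors.
\<close>

type_synonym 'f mv = "nat set \<Rightarrow> 'f"

definition mv_scale :: "'f::field \<Rightarrow> 'f mv \<Rightarrow> 'f mv" where
  "mv_scale c X = (\<lambda>A. c * X A)"

interpretation mv: vector_space mv_scale
  by unfold_locales (auto simp: mv_scale_def fun_eq_iff algebra_simps)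

definition blade :: "nat set \<Rightarrow> 'f::field mv" where
  "blade A = (\<lambda>B. if B = A then 1 else 0)"

abbreviation unit :: "'f::field mv" where
  "unit \<equiv> blade {}"

abbreviation gen :: "nat \<Rightarrow> 'f::field mv" where
  "gen a \<equiv> blade {a}"

section \<open>The geometric algebra\<close>

text \<open>
  The algebra $C\ell_{p,q,r}$ over the field \<open>'f\<close>. Over the complex numbers the algebra of
  $\mathbb{C}^{p+q,0,r}$ is obtained with the parameters \<open>p + q\<close>, \<open>0\<close>, \<open>r\<close>.
\<close>

definition eta :: "nat \<Rightarrow> nat \<Rightarrow> nat \<Rightarrow> 'f::field" where
  "eta p q a = (if a \<le> p then 1 else if a \<le> p + q then - 1 else 0)"

text \<open>
  \<open>e\<^sub>A e\<^sub>B\<close> is \<open>blade_coeff p q A B\<close> times the basis element of the symmetric difference of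
  \<open>A\<close> and \<open>B\<close>: sorting the generators costs one sign for every pair \<open>a \<in> A\<close>, \<open>b \<in> B\<close> with
  \<open>b < a\<close>, after which every \<open>a \<in> A \<inter> B\<close> contributes the square of \<open>e\<^sub>a\<close>.
\<close>

definition blade_coeff :: "nat \<Rightarrow> nat \<Rightarrow> nat set \<Rightarrow> nat set \<Rightarrow> 'f::field" where
  "blade_coeff p q A B =
     (- 1) ^ card {(a, b). a \<in> A \<and> b \<in> B \<and> b < a} * (\<Prod>a\<in>A \<inter> B. eta p q a)"

definition gp :: "nat \<Rightarrow> nat \<Rightarrow> nat \<Rightarrow> 'f::field mv \<Rightarrow> 'f mv \<Rightarrow> 'f mv" where
  "gp p q r X Y =
     (\<Sum>A\<in>Pow {1..p + q + r}. \<Sum>B\<in>Pow {1..p + q + r}.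
        mv_scale (X A * Y B * blade_coeff p q A B) (blade (sym_diff A B)))"

definition Cl :: "nat \<Rightarrow> nat \<Rightarrow> nat \<Rightarrow> 'f::field mv set" where
  "Cl p q r = mv.span (blade ` Pow {1..p + q + r})"

definition grade_space :: "nat \<Rightarrow> nat \<Rightarrow> nat \<Rightarrow> nat \<Rightarrow> 'f::field mv set" where
  "grade_space p q r k = mv.span (blade ` {A. A \<subseteq> {1..p + q + r} \<and> card A = k})"

definition even_space :: "nat \<Rightarrow> nat \<Rightarrow> nat \<Rightarrow> 'f::field mv set" where
  "even_space p q r = mv.span (blade ` {A. A \<subseteq> {1..p + q + r} \<and> even (card A)})"

definition grade_inv :: "'f::field mv \<Rightarrow> 'f mv" where
  "grade_inv X = (\<lambda>A. (- 1) ^ card A * X A)"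

definition subalgebra :: "nat \<Rightarrow> nat \<Rightarrow> nat \<Rightarrow> 'f::field mv set \<Rightarrow> bool" where
  "subalgebra p q r S \<longleftrightarrow> S \<subseteq> Cl p q r \<and> mv.subspace S \<and> unit \<in> S \<and>
     (\<forall>X\<in>S. \<forall>Y\<in>S. gp p q r X Y \<in> S)"

definition Grassmann :: "nat \<Rightarrow> nat \<Rightarrow> nat \<Rightarrow> 'f::field mv set" where
  "Grassmann p q r = subalgebra p q r hull (gen ` {p + q + 1..p + q + r})"

definition even_Grassmann :: "nat \<Rightarrow> nat \<Rightarrow> nat \<Rightarrow> 'f::field mv set" where
  "even_Grassmann p q r = Grassmann p q r \<inter> even_space p q r"

section \<open>Centralizers, complements and squares\<close>

definition center :: "nat \<Rightarrow> nat \<Rightarrow> nat \<Rightarrow> 'f::field mv set" where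
  "center p q r = {X \<in> Cl p q r. \<forall>V \<in> Cl p q r. gp p q r X V = gp p q r V X}"

definition centralizer :: "nat \<Rightarrow> nat \<Rightarrow> nat \<Rightarrow> nat \<Rightarrow> 'f::field mv set" where
  "centralizer p q r m =
     {X \<in> Cl p q r. \<forall>V \<in> grade_space p q r m. gp p q r X V = gp p q r V X}"

definition twisted_centralizer :: "nat \<Rightarrow> nat \<Rightarrow> nat \<Rightarrow> nat \<Rightarrow> 'f::field mv set" where
  "twisted_centralizer p q r m =
     {X \<in> Cl p q r. \<forall>V \<in> grade_space p q r m. gp p q r (grade_inv X) V = gp p q r V X}"

text \<open>The following two are meant for \<open>D\<close> spanned by basis elements.\<close>

definition proj :: "'f::field mv set \<Rightarrow> 'f mv \<Rightarrow> 'f mv" where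
  "proj D X = (\<lambda>A. if blade A \<in> D then X A else 0)"

definition perp :: "'f::field mv set \<Rightarrow> 'f mv set \<Rightarrow> 'f mv set" where
  "perp D H = {X \<in> H. proj D X = 0}"

definition square_zero :: "nat \<Rightarrow> nat \<Rightarrow> nat \<Rightarrow> 'f::field mv set \<Rightarrow> bool" where
  "square_zero p q r S \<longleftrightarrow> (\<forall>X\<in>S. \<forall>Y\<in>S. gp p q r X Y = 0)"

section \<open>The product is the Clifford product\<close>

lemma sum_mv_apply: "(\<Sum>i\<in>I. f i) A = (\<Sum>i\<in>I. (f i :: 'f::field mv) A)"
  by (induction I rule: infinite_finite_induct) auto

lemma mv_expand:
  assumes "finite S" "\<And>A. A \<notin> S \<Longrightarrow> X A = 0"
  shows "X = (\<Sum>A\<in>S. mv_scale (X A) (blade A))"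
proof
  fix B
  have "(\<Sum>A\<in>S. mv_scale (X A) (blade A)) B = (\<Sum>A\<in>S. if B = A then X A else 0)"
    unfolding sum_mv_apply by (rule sum.cong) (auto simp: mv_scale_def blade_def)
  then show "X B = (\<Sum>A\<in>S. mv_scale (X A) (blade A)) B"
    using assms by (auto simp: sum.delta')
qed

lemma span_blades:
  assumes "finite S"
  shows "mv.span (blade ` S) = {X :: 'f::field mv. \<forall>A. X A \<noteq> 0 \<longrightarrow> A \<in> S}" (is "_ = ?R")
proof
  have "mv.subspace ?R"
    by (rule mv.subspaceI) (auto simp: mv_scale_def, metis add_0)
  moreover have "blade ` S \<subseteq> ?R"
    by (auto simp: blade_def split: if_splits)
  ultimately show "mv.span (blade ` S) \<subseteq> ?R"
    by (rule mv.span_minimal[rotated])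
  show "?R \<subseteq> mv.span (blade ` S)"
  proof
    fix X :: "'f mv" assume "X \<in> ?R"
    then have X: "X = (\<Sum>A\<in>S. mv_scale (X A) (blade A))"
      using assms by (intro mv_expand) auto
    show "X \<in> mv.span (blade ` S)"
      by (subst X) (intro mv.span_sum mv.span_scale mv.span_base imageI)
  qed
qed

lemma Cl_iff: "X \<in> Cl p q r \<longleftrightarrow> (\<forall>A. X A \<noteq> 0 \<longrightarrow> A \<subseteq> {1..p + q + r})"
  unfolding Cl_def by (subst span_blades) auto

lemma grade_space_iff:
  "X \<in> grade_space p q r k \<longleftrightarrow> (\<forall>A. X A \<noteq> 0 \<longrightarrow> A \<subseteq> {1..p + q + r} \<and> card A = k)"
  unfolding grade_space_def by (subst span_blades) auto

lemma even_space_iff: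
  "X \<in> even_space p q r \<longleftrightarrow> (\<forall>A. X A \<noteq> 0 \<longrightarrow> A \<subseteq> {1..p + q + r} \<and> even (card A))"
  unfolding even_space_def by (subst span_blades) auto

lemma blades_independent: "mv.independent (blade ` S :: 'f::field mv set)"
proof (rule ccontr)
  assume "\<not> mv.independent (blade ` S :: 'f mv set)"
  then obtain a where a: "a \<in> blade ` S" "a \<in> mv.span (blade ` S - {a :: 'f mv})"
    unfolding mv.dependent_def by auto
  then obtain A where A: "a = blade A" by auto
  have "mv.subspace {X :: 'f mv. X A = 0}"
    by (rule mv.subspaceI) (auto simp: mv_scale_def)
  moreover have "blade ` S - {a} \<subseteq> {X :: 'f mv. X A = 0}"
    by (auto simp: A blade_def)
  ultimately have "a \<in> {X :: 'f mv. X A = 0}"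
    using a(2) mv.span_minimal by blast
  then show False by (simp add: A blade_def)
qed

lemma gp_blade:
  assumes "A \<subseteq> {1..p + q + r}" "B \<subseteq> {1..p + q + r}"
  shows "gp p q r (blade A) (blade B) = mv_scale (blade_coeff p q A B) (blade (sym_diff A B))"
proof -
  have *: "mv_scale (blade A A' * blade B B' * blade_coeff p q A' B') (blade (sym_diff A' B')) =
      (if B' = B then if A' = A then
         mv_scale (blade_coeff p q A B) (blade (sym_diff A B)) else 0 else 0)" for A' B'
    by (auto simp: blade_def mv_scale_def fun_eq_iff)
  show ?thesis
    unfolding gp_def * using assms by (simp add: sum.delta)
qed

lemma gp_expand:
  "gp p q r X Y = (\<Sum>A\<in>Pow {1..p + q + r}. \<Sum>B\<in>Pow {1..p + q + r}.
     mv_scale (X A * Y B) (gp p q r (blade A) (blade B)))"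
  unfolding gp_def[of p q r X Y] by (intro sum.cong refl) (simp add: gp_blade)

lemma gp_add_left: "gp p q r (X + Y) Z = gp p q r X Z + gp p q r Y Z"
  by (simp add: gp_def ring_distribs mv.scale_left_distrib sum.distrib)

lemma gp_add_right: "gp p q r X (Y + Z) = gp p q r X Y + gp p q r X Z"
  by (simp add: gp_def ring_distribs mv.scale_left_distrib sum.distrib)

lemma gp_scale_left: "gp p q r (mv_scale c X) Y = mv_scale c (gp p q r X Y)"
  by (simp add: gp_def mv.scale_sum_right mv_scale_def[of c X] mult.assoc)

lemma gp_scale_right: "gp p q r X (mv_scale c Y) = mv_scale c (gp p q r X Y)"
  by (simp add: gp_def mv.scale_sum_right mv_scale_def[of c Y] ac_simps)

lemma gp_zero_left: "gp p q r 0 Y = 0"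
  by (simp add: gp_def)

lemma gp_zero_right: "gp p q r X 0 = 0"
  by (simp add: gp_def)

lemma gp_sum_left: "gp p q r (\<Sum>i\<in>I. f i) Y = (\<Sum>i\<in>I. gp p q r (f i) Y)"
  by (induction I rule: infinite_finite_induct) (simp_all only: sum.infinite sum.empty sum.insert gp_zero_left gp_add_left not_False_eq_True)

lemma gp_sum_right: "gp p q r X (\<Sum>i\<in>I. f i) = (\<Sum>i\<in>I. gp p q r X (f i))"
  by (induction I rule: infinite_finite_induct) (simp_all only: sum.infinite sum.empty sum.insert gp_zero_right gp_add_right not_False_eq_True)

lemma gp_closed: "gp p q r X Y \<in> Cl p q r"
  unfolding gp_def Cl_def
  by (intro mv.span_sum mv.span_scale mv.span_base) auto

lemma blade_coeff_prod:
  assumes "finite A" "finite B"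
  shows "blade_coeff p q A B =
    (\<Prod>a\<in>A. \<Prod>b\<in>B. if b < a then - 1 else 1) * (\<Prod>a\<in>A \<inter> B. eta p q a :: 'f::field)"
proof -
  have "(\<Prod>a\<in>A. \<Prod>b\<in>B. if b < a then - 1 else (1::'f)) =
      (\<Prod>x\<in>A \<times> B. if snd x < fst x then - 1 else 1)"
    by (simp add: prod.cartesian_product case_prod_beta)
  also have "\<dots> = (\<Prod>x\<in>{x \<in> A \<times> B. snd x < fst x}. - 1)"
    using assms by (intro prod.inter_filter[symmetric]) auto
  also have "{x \<in> A \<times> B. snd x < fst x} = {(a, b). a \<in> A \<and> b \<in> B \<and> b < a}"
    by auto
  finally show ?thesis
    by (simp add: blade_coeff_def)
qed

lemma prod_sym_diff:
  fixes f :: "'a \<Rightarrow> 'f::field"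
  assumes "finite A" "finite B" "\<And>x. f x * f x = 1"
  shows "prod f (sym_diff A B) = prod f A * prod f B"
proof -
  have "prod f A = prod f (A - B) * prod f (A \<inter> B)" "prod f B = prod f (B - A) * prod f (A \<inter> B)"
    using assms(1,2) by (metis prod.Int_Diff mult.commute Int_commute)+
  moreover have "prod f (A \<inter> B) * prod f (A \<inter> B) = 1"
    using assms(3) by (simp add: prod.distrib[symmetric])
  moreover have "prod f (sym_diff A B) = prod f (A - B) * prod f (B - A)"
    using assms by (intro prod.union_disjoint) auto
  ultimately show ?thesis
    by (simp add: ac_simps)
qed

lemma blade_coeff_assoc:
  assumes "finite A" "finite B" "finite C"
  shows "blade_coeff p q A B * blade_coeff p q (sym_diff A B) C =
    blade_coeff p q B C * (blade_coeff p q A (sym_diff B C) :: 'f::field)"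
proof -
  define s :: "nat \<Rightarrow> nat \<Rightarrow> 'f" where "s = (\<lambda>a b. if b < a then - 1 else 1)"
  define S :: "nat set \<Rightarrow> nat set \<Rightarrow> 'f" where "S = (\<lambda>A B. \<Prod>a\<in>A. \<Prod>b\<in>B. s a b)"
  define m :: "nat set \<Rightarrow> 'f" where "m = prod (eta p q)"
  have c: "blade_coeff p q A B = S A B * m (A \<inter> B)" if "finite A" "finite B" for A B
    using blade_coeff_prod[OF that] by (simp add: S_def s_def m_def)
  have s: "s a b * s a b = 1" for a b by (simp add: s_def)
  have l: "S (sym_diff A B) C = S A C * S B C"
    unfolding S_def using assms
    by (intro prod_sym_diff) (auto simp: prod.distrib[symmetric] s)
  have r: "S A (sym_diff B C) = S A B * S A C"
    unfolding S_def using assms prod.distrib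
    by (subst prod_sym_diff) (auto simp: s prod.distrib)
  have "m (A \<inter> B) * m (sym_diff A B \<inter> C) = m ((A \<inter> B) \<union> (sym_diff A B \<inter> C))"
    unfolding m_def using assms by (intro prod.union_disjoint[symmetric]) auto
  also have "(A \<inter> B) \<union> (sym_diff A B \<inter> C) = (B \<inter> C) \<union> (A \<inter> sym_diff B C)"
    by auto
  also have "m \<dots> = m (B \<inter> C) * m (A \<inter> sym_diff B C)"
    unfolding m_def using assms by (intro prod.union_disjoint) auto
  finally have "m (A \<inter> B) * m (sym_diff A B \<inter> C) = m (B \<inter> C) * m (A \<inter> sym_diff B C)" .
  then show ?thesis
    using assms by (simp add: c l r ac_simps)
qed

lemma gp_assoc: "gp p q r (gp p q r X Y) Z = gp p q r X (gp p q r Y Z)"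
proof -
  let ?N = "Pow {1..p + q + r}"
  have b: "gp p q r (gp p q r (blade A) (blade B)) (blade C) =
      gp p q r (blade A) (gp p q r (blade B) (blade C) :: 'a mv)"
    if "A \<in> ?N" "B \<in> ?N" "C \<in> ?N" for A B C
  proof -
    have f: "finite A" "finite B" "finite C"
      using that by (auto intro: finite_subset)
    have d: "sym_diff (sym_diff A B) C = sym_diff A (sym_diff B C)" by auto
    have u: "sym_diff A B \<subseteq> {1..p + q + r}" "sym_diff B C \<subseteq> {1..p + q + r}"
      using that by auto
    have "gp p q r (gp p q r (blade A) (blade B)) (blade C) =
        mv_scale (blade_coeff p q A B * blade_coeff p q (sym_diff A B) C)
          (blade (sym_diff (sym_diff A B) C) :: 'a mv)"
      using that u by (simp only: gp_blade gp_scale_left Pow_iff mv.scale_scale)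
    also have "\<dots> = mv_scale (blade_coeff p q B C * blade_coeff p q A (sym_diff B C))
          (blade (sym_diff A (sym_diff B C)))"
      by (simp only: blade_coeff_assoc[OF f] d)
    also have "\<dots> = gp p q r (blade A) (gp p q r (blade B) (blade C))"
      using that u by (simp only: gp_blade gp_scale_right Pow_iff mv.scale_scale)
    finally show ?thesis .
  qed
  have l: "gp p q r W Z = (\<Sum>C\<in>?N. mv_scale (Z C) (gp p q r W (blade C)))" for W Z :: "'a mv"
  proof -
    have "gp p q r W (blade C) = (\<Sum>A\<in>?N. mv_scale (W A) (gp p q r (blade A) (blade C)))"
      if "C \<in> ?N" for C
    proof -
      have "mv_scale (W A * blade C B) V = (if B = C then mv_scale (W A) V else 0)"
        for A B and V :: "'a mv"
        by (auto simp: blade_def)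
      then show ?thesis
        using that by (subst gp_expand) (simp add: sum.delta)
    qed
    then have "(\<Sum>C\<in>?N. mv_scale (Z C) (gp p q r W (blade C))) =
      (\<Sum>C\<in>?N. \<Sum>A\<in>?N. mv_scale (W A * Z C) (gp p q r (blade A) (blade C)))"
      by (intro sum.cong refl) (simp add: mv.scale_sum_right mult.commute)
    then show ?thesis
      by (subst gp_expand) (subst sum.swap, rule sym)
  qed
  have "gp p q r (gp p q r X Y) Z = (\<Sum>C\<in>?N. \<Sum>A\<in>?N. \<Sum>B\<in>?N.
      mv_scale (X A * Y B * Z C) (gp p q r (gp p q r (blade A) (blade B)) (blade C)))"
    unfolding l[of "gp p q r X Y" Z]
    unfolding gp_expand[of p q r X Y] gp_sum_left gp_scale_left
      mv.scale_sum_right mv.scale_scale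
    by (intro sum.cong refl) (simp only: ac_simps)
  also have "\<dots> = (\<Sum>C\<in>?N. \<Sum>A\<in>?N. \<Sum>B\<in>?N.
      mv_scale (X A * Y B * Z C) (gp p q r (blade A) (gp p q r (blade B) (blade C))))"
    by (intro sum.cong refl) (simp only: b)
  also have "\<dots> = (\<Sum>A\<in>?N. \<Sum>B\<in>?N. \<Sum>C\<in>?N.
      mv_scale (X A * Y B * Z C) (gp p q r (blade A) (gp p q r (blade B) (blade C))))"
    by (subst sum.swap) (intro sum.cong refl sum.swap)
  also have "\<dots> = (\<Sum>A\<in>?N. mv_scale (X A) (gp p q r (blade A) (gp p q r Y Z)))"
    unfolding gp_expand[of p q r Y Z] gp_sum_right gp_scale_right
      mv.scale_sum_right mv.scale_scale
    by (intro sum.cong refl) (simp only: ac_simps)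
  also have "\<dots> = gp p q r X (gp p q r Y Z)"
  proof -
    let ?V = "gp p q r Y Z"
    have "gp p q r (blade A) ?V = (\<Sum>B\<in>?N. mv_scale (?V B) (gp p q r (blade A) (blade B)))" for A
      by (rule l)
    then show ?thesis
      by (subst gp_expand[of p q r X ?V]) (simp add: mv.scale_sum_right)
  qed
  finally show ?thesis .
qed

lemma Cl_expand:
  "X \<in> Cl p q r \<Longrightarrow> X = (\<Sum>A\<in>Pow {1..p + q + r}. mv_scale (X A) (blade A))"
  by (rule mv_expand) (auto simp: Cl_iff)

lemma gp_unit_left: "gp p q r unit X = X" if "X \<in> Cl p q r"
proof -
  have "gp p q r unit (\<Sum>A\<in>Pow {1..p + q + r}. mv_scale (X A) (blade A)) =
      (\<Sum>A\<in>Pow {1..p + q + r}. mv_scale (X A) (blade A))"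
    unfolding gp_sum_right
    by (intro sum.cong refl) (simp add: gp_scale_right gp_blade blade_coeff_def)
  then show ?thesis
    using Cl_expand[OF that] by simp
qed

lemma gp_unit_right: "gp p q r X unit = X" if "X \<in> Cl p q r"
proof -
  have "gp p q r (\<Sum>A\<in>Pow {1..p + q + r}. mv_scale (X A) (blade A)) unit =
      (\<Sum>A\<in>Pow {1..p + q + r}. mv_scale (X A) (blade A))"
    unfolding gp_sum_left
    by (intro sum.cong refl) (simp add: gp_scale_left gp_blade blade_coeff_def)
  then show ?thesis
    using Cl_expand[OF that] by simp
qed

lemma gen_relation:
  assumes "a \<in> {1..p + q + r}" "b \<in> {1..p + q + r}"
  shows "gp p q r (gen a) (gen b) + gp p q r (gen b) (gen a) =
    mv_scale (2 * (if a = b then eta p q a else 0)) (unit :: 'f::field mv)"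
proof -
  have *: "blade_coeff p q {x} {y} =
      (if y < x then - 1 else if x = y then eta p q x else (1::'f))" for x y
    by (subst blade_coeff_prod) auto
  show ?thesis
  proof (cases "a = b")
    case True
    then show ?thesis
      using assms by (simp add: gp_blade * mv.scale_left_distrib[symmetric])
  next
    case False
    then have "sym_diff {a} {b} = {a, b}" "sym_diff {b} {a} = {a, b}" by auto
    then show ?thesis
      using assms False
      by (cases "a < b") (simp_all add: gp_blade * mv.scale_left_distrib[symmetric])
  qed
qed

lemma blade_insert_less:
  assumes "insert a A \<subseteq> {1..p + q + r}" "\<And>b. b \<in> A \<Longrightarrow> a < b"
  shows "blade (insert a A) = gp p q r (gen a) (blade A)"
proof -
  have "a \<notin> A" using assms(2) by blast
  then have "sym_diff {a} A = insert a A" "{a} \<inter> A = {}" by auto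
  moreover have e: "{(x, b). x \<in> {a} \<and> b \<in> A \<and> b < x} = {}"
    using assms(2) by fastforce
  ultimately show ?thesis
    using assms(1) by (subst gp_blade) (simp_all only: blade_coeff_def e, simp_all)
qed

lemma blade_eq_product:
  assumes "A \<subseteq> {1..p + q + r}"
  shows "blade A = foldr (\<lambda>a. gp p q r (gen a)) (sorted_list_of_set A) (unit :: 'f::field mv)"
proof -
  have "blade (set xs) = foldr (\<lambda>a. gp p q r (gen a)) xs (unit :: 'f mv)"
    if "sorted_wrt (<) xs" "set xs \<subseteq> {1..p + q + r}" for xs
    using that
  proof (induction xs)
    case (Cons a xs)
    then have "blade (insert a (set xs)) = gp p q r (gen a) (blade (set xs) :: 'f mv)"
      by (intro blade_insert_less) auto
    moreover have "blade (set xs) = foldr (\<lambda>a. gp p q r (gen a)) xs (unit :: 'f mv)"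
      using Cons by simp
    ultimately show ?case
      by (simp only: list.set foldr_Cons comp_apply)
  qed simp
  from this[of "sorted_list_of_set A"] show ?thesis
    using assms finite_subset[OF assms] by simp
qed

lemma Cl_subalgebra: "subalgebra p q r (Cl p q r)"
  unfolding subalgebra_def
  by (auto simp: gp_closed) (auto simp: Cl_def intro: mv.span_base)

lemma Grassmann_eq:
  "Grassmann p q r = mv.span (blade ` Pow {p + q + 1..p + q + r} :: 'f::field mv set)" (is "_ = ?L")
proof (unfold Grassmann_def, rule hull_unique)
  let ?M = "{p + q + 1..p + q + r}"
  have sub: "?M \<subseteq> {1..p + q + r}" by auto
  have L: "X \<in> ?L \<longleftrightarrow> (\<forall>A. X A \<noteq> 0 \<longrightarrow> A \<subseteq> ?M)" for X :: "'f mv"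
    by (subst span_blades) auto
  show "gen ` ?M \<subseteq> ?L"
    by (auto intro!: mv.span_base)
  show "subalgebra p q r ?L"
    unfolding subalgebra_def
  proof (intro conjI ballI)
    show "?L \<subseteq> Cl p q r"
      unfolding Cl_def using sub by (intro mv.span_mono image_mono) auto
    show "unit \<in> ?L" by (auto intro!: mv.span_base)
    fix X Y :: "'f mv" assume XY: "X \<in> ?L" "Y \<in> ?L"
    have "mv_scale (X A * Y B * blade_coeff p q A B) (blade (sym_diff A B)) \<in> ?L" for A B
    proof (cases "X A = 0 \<or> Y B = 0")
      case True
      then have "X A * Y B * blade_coeff p q A B = 0" by auto
      then show ?thesis by (simp only: mv.scale_zero_left mv.span_zero)
    next
      case False
      then have "A \<subseteq> ?M" "B \<subseteq> ?M" using XY L by blast+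
      then show ?thesis by (intro mv.span_scale mv.span_base imageI) auto
    qed
    then show "gp p q r X Y \<in> ?L"
      unfolding gp_def by (intro mv.span_sum)
  qed simp
  fix T :: "'f mv set" assume T: "gen ` ?M \<subseteq> T" "subalgebra p q r T"
  have "blade A \<in> T" if "A \<subseteq> ?M" for A
  proof -
    have "foldr (\<lambda>a. gp p q r (gen a)) xs unit \<in> T" if "set xs \<subseteq> ?M" for xs
      using that
    proof (induction xs)
      case Nil
      then show ?case using T(2) by (simp add: subalgebra_def)
    next
      case (Cons a xs)
      then have "gen a \<in> T" "foldr (\<lambda>a. gp p q r (gen a)) xs unit \<in> T"
        using T(1) by auto
      then show ?case using T(2) unfolding subalgebra_def by simp
    qed
    moreover have "set (sorted_list_of_set A) \<subseteq> ?M"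
      using that finite_subset[OF that] by simp
    ultimately show ?thesis
      using blade_eq_product[OF order_trans[OF that sub], where 'f = 'f] by metis
  qed
  then show "?L \<subseteq> T"
    using T(2) by (intro mv.span_minimal) (auto simp: subalgebra_def)
qed

end

theory Submission
  imports Defs
begin

text \<open>
  Everything here is decided on index sets. Let \<open>N = {1..n}\<close> index all generators and
  \<open>M\<close> the null ones. Multiplying by a single basis element \<open>e\<^sub>B\<close> permutes the basis elements
  up to factors, so the (twisted) commutation of \<open>X\<close> with \<open>e\<^sub>B\<close> can be read off one coordinate at
  a time: whenever \<open>e\<^sub>A\<close> occurs in \<open>X\<close>, either \<open>A\<close> and \<open>B\<close> share a null index, so that
  both products vanish, or the sign \<open>(-1)\<close> to the power \<open>|A||B| - |A \<inter> B|\<close>, corrected by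
  \<open>(-1)\<close> to the power \<open>|A|\<close> in the twisted case, is \<open>1\<close>.

  Letting \<open>B\<close> run over all sets of a fixed size that avoid \<open>A \<inter> M\<close>, this becomes a condition on
  the three numbers \<open>m = |A \<inter> M|\<close>, \<open>a = |A - M|\<close>, \<open>c = |N - A|\<close> only (\<open>parity_rule\<close>, established
  in \<open>centralizer_parity_rule\<close> and \<open>twisted_centralizer_parity_rule\<close>). The condition is severe: if
  both \<open>a\<close> and \<open>c\<close> are positive and \<open>a + c\<close> exceeds the size of \<open>B\<close>, exchanging one element of \<open>B\<close>
  changes the parity of \<open>|A \<inter> B|\<close>. What survives outside the even Grassmann elements is \<open>A = N\<close>
  together with sets that contain all but at most three indices as null indices. In the dimensions
  considered, \<open>A\<close> then has more null indices than there are indices missing from \<open>A\<close>, that is,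
  \<open>c < m\<close>.

  Two such sets \<open>A\<close>, \<open>B\<close> share a null index, for otherwise
  \<open>|A \<inter> M| \<le> |N - B| < |B \<inter> M| \<le> |N - A| < |A \<inter> M|\<close>. So any two basis elements that occur
  multiply to zero (\<open>square_zero_perpI\<close>); there is no cancellation between different terms.
\<close>

section \<open>Commuting with a single basis element\<close>

lemma gp_blade_right_apply:
  assumes "A \<subseteq> {1..p + q + r}" "B \<subseteq> {1..p + q + r}"
  shows "gp p q r X (blade B) (sym_diff A B) = X A * blade_coeff p q A B"
proof -
  let ?N = "Pow {1..p + q + r}"
  have inj: "sym_diff A B = sym_diff A' B \<longleftrightarrow> A' = A" for A' :: "nat set" by blast
  have "gp p q r X (blade B) (sym_diff A B) =
    (\<Sum>A'\<in>?N. \<Sum>B'\<in>?N. if B' = B then (if A' = A then X A * blade_coeff p q A B else 0) else 0)"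
    unfolding gp_def sum_mv_apply
    by (intro sum.cong refl) (auto simp: mv_scale_def blade_def inj)
  also have "\<dots> = X A * blade_coeff p q A B"
    using assms by (simp add: sum.delta)
  finally show ?thesis .
qed

lemma gp_blade_left_apply:
  assumes "A \<subseteq> {1..p + q + r}" "B \<subseteq> {1..p + q + r}"
  shows "gp p q r (blade B) X (sym_diff A B) = X A * blade_coeff p q B A"
proof -
  let ?N = "Pow {1..p + q + r}"
  have inj: "sym_diff A B = sym_diff B A' \<longleftrightarrow> A' = A" for A' :: "nat set" by blast
  have "gp p q r (blade B) X (sym_diff A B) =
    (\<Sum>B'\<in>?N. \<Sum>A'\<in>?N. if A' = A then (if B' = B then X A * blade_coeff p q B A else 0) else 0)"
    unfolding gp_def sum_mv_apply
    by (intro sum.cong refl) (auto simp: mv_scale_def blade_def inj)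
  also have "\<dots> = X A * blade_coeff p q B A"
    using assms by (simp add: sum.delta)
  finally show ?thesis .
qed

text \<open>
  Every pair in \<open>A \<times> B\<close> is an inversion for \<open>e\<^sub>A e\<^sub>B\<close>, an inversion for \<open>e\<^sub>B e\<^sub>A\<close>, or lies
  on the diagonal. This is what makes the ratio of the two sorting signs depend on cardinalities only.
\<close>

lemma card_inversions:
  fixes A B :: "nat set"
  assumes "finite A" "finite B"
  shows "card {(a, b). a \<in> A \<and> b \<in> B \<and> b < a} + card {(b, a). b \<in> B \<and> a \<in> A \<and> a < b}
    + card (A \<inter> B) = card A * card B"
proof -
  let ?P = "{(a, b). a \<in> A \<and> b \<in> B \<and> b < a}"
  let ?Q = "{(b, a). b \<in> B \<and> a \<in> A \<and> a < b}"
  let ?D = "(\<lambda>a. (a, a)) ` (A \<inter> B)"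
  have P: "finite ?P" by (rule finite_subset[of _ "A \<times> B"]) (use assms in auto)
  have Q: "finite ?Q" by (rule finite_subset[of _ "B \<times> A"]) (use assms in auto)
  have Q': "card (prod.swap ` ?Q) = card ?Q" by (intro card_image inj_onI) auto
  have D: "card ?D = card (A \<inter> B)" by (intro card_image inj_onI) auto
  have "A \<times> B = (?P \<union> prod.swap ` ?Q) \<union> ?D" by (auto simp: image_iff)
  then have "card (A \<times> B) = card ((?P \<union> prod.swap ` ?Q) \<union> ?D)" by simp
  also have "\<dots> = card (?P \<union> prod.swap ` ?Q) + card ?D"
    using P Q assms by (intro card_Un_disjoint) auto
  also have "card (?P \<union> prod.swap ` ?Q) = card ?P + card (prod.swap ` ?Q)"
    using P Q by (intro card_Un_disjoint) auto
  finally show ?thesis by (simp add: Q' D card_cartesian_product)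
qed

lemma blade_coeff_null:
  assumes "finite A" "A \<inter> B \<inter> {p + q + 1..} \<noteq> {}"
  shows "blade_coeff p q A B = 0"
  using assms by (force simp: blade_coeff_def eta_def)

lemma even_exponent_if_blade_coeffs_agree:
  assumes "finite A" "finite B" "A \<inter> B \<inter> {p + q + 1..} = {}"
    and eq: "(- 1) ^ t * blade_coeff p q A B = (blade_coeff p q B A :: 'f::field_char_0)"
  shows "even (t + card A * card B + card (A \<inter> B))"
proof -
  let ?x = "card {(a, b). a \<in> A \<and> b \<in> B \<and> b < a}"
  let ?y = "card {(b, a). b \<in> B \<and> a \<in> A \<and> a < b}"
  let ?e = "\<Prod>a\<in>A \<inter> B. eta p q a :: 'f"
  have "?e \<noteq> 0"
    using assms(1-3) by (auto simp: eta_def)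
  moreover have "(- 1) ^ (t + ?x) * ?e = (- 1) ^ ?y * ?e"
    using eq by (simp add: blade_coeff_def power_add Int_commute mult.assoc)
  ultimately have "(- 1) ^ (t + ?x) = (- 1 :: 'f) ^ ?y"
    by simp
  then have "even (t + ?x) \<longleftrightarrow> even ?y"
    by (cases "even (t + ?x)"; cases "even ?y") simp_all
  then show ?thesis
    unfolding card_inversions[OF assms(1,2), symmetric] by (simp, blast)
qed

text \<open>
  The exponent \<open>t\<close> unifies ordinary (\<open>t = 0\<close>) and twisted (\<open>t = 1\<close>) commutation.
\<close>

lemma even_exponent_if_commutes:
  fixes X :: "'f::field_char_0 mv"
  assumes com: "gp p q r (\<lambda>A. (- 1) ^ (t * card A) * X A) (blade B) = gp p q r (blade B) X"
    and A: "X A \<noteq> 0" "A \<subseteq> {1..p + q + r}" and B: "B \<subseteq> {1..p + q + r}"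
    and null: "A \<inter> B \<inter> {p + q + 1..} = {}"
  shows "even (t * card A + card A * card B + card (A \<inter> B))"
proof (rule even_exponent_if_blade_coeffs_agree)
  show "finite A" "finite B"
    using A(2) B by (auto intro: finite_subset)
  have "(- 1) ^ (t * card A) * X A * blade_coeff p q A B = X A * blade_coeff p q B A"
    using fun_cong[OF com, of "sym_diff A B"]
    by (simp only: gp_blade_right_apply[OF A(2) B] gp_blade_left_apply[OF A(2) B])
  then show "(- 1) ^ (t * card A) * blade_coeff p q A B = (blade_coeff p q B A :: 'f)"
    using A(1) by simp
qed fact

section \<open>Parity conditions on the index sets that occur\<close>

text \<open>
  Here \<open>m\<close>, \<open>a\<close> and \<open>c\<close> stand for the numbers of null indices in \<open>A\<close>, of the other indices in \<open>A\<close>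
  and of indices outside \<open>A\<close>. A set of size \<open>k\<close> that avoids the null part of \<open>A\<close> takes \<open>i\<close> of the
  \<open>a\<close> and \<open>j\<close> of the \<open>c\<close> indices; its basis element commutes with \<open>e\<^sub>A\<close> up to the sign
  \<open>(-1)\<close> to the power \<open>k(m + a) + i\<close>. The factor \<open>s\<close> is \<open>k\<close> for centralizers and \<open>k + 1\<close> for
  twisted centralizers.
\<close>

definition parity_rule :: "nat \<Rightarrow> nat \<Rightarrow> nat \<Rightarrow> nat \<Rightarrow> nat \<Rightarrow> bool" where
  "parity_rule s k m a c \<longleftrightarrow> (\<forall>i j. i \<le> a \<and> j \<le> c \<and> i + j = k \<longrightarrow> even (s * (m + a) + i))"

lemma parity_rule_if_commutes:
  fixes X :: "'f::field_char_0 mv"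
  assumes com: "\<And>V. V \<in> grade_space p q r k \<Longrightarrow>
      gp p q r (\<lambda>A. (- 1) ^ (t * card A) * X A) V = gp p q r V X"
    and A: "X A \<noteq> 0" "A \<subseteq> {1..p + q + r}"
  shows "parity_rule (t + k) k (card (A \<inter> {p + q + 1..})) (card (A - {p + q + 1..}))
    (card ({1..p + q + r} - A))"
  unfolding parity_rule_def
proof (intro allI impI, elim conjE)
  fix i j
  assume i: "i \<le> card (A - {p + q + 1..})" and j: "j \<le> card ({1..p + q + r} - A)"
    and k: "i + j = k"
  obtain I where I: "I \<subseteq> A - {p + q + 1..}" "card I = i" "finite I"
    using obtain_subset_with_card_n[OF i] by metis
  obtain J where J: "J \<subseteq> {1..p + q + r} - A" "card J = j" "finite J"
    using obtain_subset_with_card_n[OF j] by metis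
  have B: "I \<union> J \<subseteq> {1..p + q + r}" using I(1) J(1) A(2) by blast
  have card: "card (I \<union> J) = k"
    using I J k by (subst card_Un_disjoint) auto
  have "blade (I \<union> J) \<in> (grade_space p q r k :: 'f mv set)"
    unfolding grade_space_iff using B card by (auto simp: blade_def split: if_splits)
  from even_exponent_if_commutes[where t = t, OF com[OF this] A B]
  have "even (t * card A + card A * k + card (A \<inter> (I \<union> J)))"
    using I(1) J(1) card by auto
  moreover have "A \<inter> (I \<union> J) = I" using I(1) J(1) by blast
  moreover have "card (A \<inter> {p + q + 1..}) + card (A - {p + q + 1..}) = card A"
    using card_Int_Diff[OF finite_subset[OF A(2)], of "{p + q + 1..}"] by simp
  ultimately show "even ((t + k) * (card (A \<inter> {p + q + 1..}) + card (A - {p + q + 1..})) + i)"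
    using I(2) by (simp add: algebra_simps)
qed

lemma centralizer_parity_rule:
  fixes X :: "'f::field_char_0 mv"
  assumes "X \<in> centralizer p q r k" "X A \<noteq> 0" "A \<subseteq> {1..p + q + r}"
  shows "parity_rule k k (card (A \<inter> {p + q + 1..})) (card (A - {p + q + 1..}))
    (card ({1..p + q + r} - A))"
  using parity_rule_if_commutes[of p q r k 0 X A] assms by (simp add: centralizer_def)

lemma twisted_centralizer_parity_rule:
  fixes X :: "'f::field_char_0 mv"
  assumes "X \<in> twisted_centralizer p q r k" "X A \<noteq> 0" "A \<subseteq> {1..p + q + r}"
  shows "parity_rule (Suc k) k (card (A \<inter> {p + q + 1..})) (card (A - {p + q + 1..}))
    (card ({1..p + q + r} - A))"
  using parity_rule_if_commutes[of p q r k 1 X A] assms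
  by (simp add: twisted_centralizer_def grade_inv_def)

lemma center_subset_centralizer: "center p q r \<subseteq> centralizer p q r k"
  by (auto simp: center_def centralizer_def Cl_iff grade_space_iff)

lemma parity_rule_1D:
  assumes "parity_rule s 1 m a c"
  shows "1 \<le> c \<Longrightarrow> even (s * (m + a))" "1 \<le> a \<Longrightarrow> odd (s * (m + a))"
  using assms[unfolded parity_rule_def, rule_format, of 0 1]
    assms[unfolded parity_rule_def, rule_format, of 1 0] by simp_all

lemma parity_rule_2D:
  assumes "parity_rule s 2 m a c"
  shows "2 \<le> c \<Longrightarrow> even (s * (m + a))" "1 \<le> a \<Longrightarrow> 1 \<le> c \<Longrightarrow> odd (s * (m + a))"
    "2 \<le> a \<Longrightarrow> even (s * (m + a))"
  using assms[unfolded parity_rule_def, rule_format, of 0 2]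
    assms[unfolded parity_rule_def, rule_format, of 1 1]
    assms[unfolded parity_rule_def, rule_format, of 2 0] by simp_all

lemma parity_rule_3D:
  assumes "parity_rule s 3 m a c"
  shows "3 \<le> c \<Longrightarrow> even (s * (m + a))" "1 \<le> a \<Longrightarrow> 2 \<le> c \<Longrightarrow> odd (s * (m + a))"
    "2 \<le> a \<Longrightarrow> 1 \<le> c \<Longrightarrow> even (s * (m + a))" "3 \<le> a \<Longrightarrow> odd (s * (m + a))"
  using assms[unfolded parity_rule_def, rule_format, of 0 3]
    assms[unfolded parity_rule_def, rule_format, of 1 2]
    assms[unfolded parity_rule_def, rule_format, of 2 1]
    assms[unfolded parity_rule_def, rule_format, of 3 0] by simp_all

section \<open>More null indices than missing ones\<close>

text \<open>
  All values from three on behave alike in the parity rules for \<open>k \<le> 3\<close>, so that after this case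
  distinction on \<open>a\<close> and \<open>c\<close> only the parity and the size of \<open>m\<close> are left to consider.
\<close>

lemma cases_up_to_3:
  fixes a :: nat
  obtains "a = 0" | "a = 1" | "a = 2" | "a \<ge> 3"
  by linarith

text \<open>
  An index set with these counts is not an even set of null indices, and it contains a null
  index in case it contains all indices, as \<open>r \<noteq> 0\<close>.
\<close>

definition admissible :: "nat \<Rightarrow> nat \<Rightarrow> nat \<Rightarrow> bool" where
  "admissible m a c \<longleftrightarrow> (0 < a \<or> odd m) \<and> (c = 0 \<longrightarrow> 0 < m)"

text \<open>
  The case \<open>c = 0\<close> is immediate. A generator missing from \<open>A\<close> forces \<open>|A|\<close> to be even, which no
  non-null generator in \<open>A\<close> tolerates; but \<open>a = 0\<close> with \<open>m\<close> even is not admissible.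
\<close>

lemma more_null_center:
  assumes "parity_rule 1 1 m a c" "admissible m a c" "m + a + c = n" "n \<ge> 1"
  shows "c < m"
  using parity_rule_1D[OF assms(1)] assms(2-)[unfolded admissible_def]
  by (cases a rule: cases_up_to_3; cases c rule: cases_up_to_3; simp; presburger)

text \<open>
  Unless \<open>c = 0\<close>, admissible counts satisfy \<open>a + c \<le> 2\<close>, or \<open>a + c = 3\<close> with \<open>a > 0\<close>. In dimension
  five the latter allows \<open>m = 2\<close>, \<open>a = 1\<close>, \<open>c = 2\<close>, where the conclusion fails. In dimension four
  parity rules it out, and \<open>m = c = 2\<close> would leave \<open>a = 0\<close> with \<open>m\<close> even.
\<close>

lemma more_null_centralizer_3:
  assumes "parity_rule 3 3 m a c" "admissible m a c" "m + a + c = n" "n = 4 \<or> n \<ge> 6"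
  shows "c < m"
  using parity_rule_3D[OF assms(1)] assms(2-)[unfolded admissible_def]
  by (cases a rule: cases_up_to_3; cases c rule: cases_up_to_3; simp; presburger)

text \<open>
  Here \<open>c > 0\<close> implies \<open>a + c \<le> 2\<close>, and \<open>m\<close> is even if \<open>a + c = 2\<close>. The latter prevents \<open>m = 1\<close>
  in dimension three.
\<close>

lemma more_null_twisted_centralizers_2_3:
  assumes "parity_rule 3 2 m a c" "parity_rule 4 3 m a c"
    "admissible m a c" "m + a + c = n" "n \<ge> 3"
  shows "c < m"
  using parity_rule_2D[OF assms(1)] parity_rule_3D[OF assms(2)] assms(3-)[unfolded admissible_def]
  by (cases a rule: cases_up_to_3; cases c rule: cases_up_to_3; simp; presburger)

text \<open>
  Twisted commutation with single generators already implies \<open>a = 0\<close>, and then the rule for pairs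
  makes \<open>m\<close> even as soon as \<open>c \<ge> 2\<close>. So \<open>c \<le> 1\<close>.
\<close>

lemma more_null_twisted_centralizers_1_2:
  assumes "parity_rule 2 1 m a c" "parity_rule 3 2 m a c"
    "admissible m a c" "m + a + c = n" "n \<ge> 3"
  shows "c < m"
  using parity_rule_1D[OF assms(1)] parity_rule_2D[OF assms(2)] assms(3-)[unfolded admissible_def]
  by (cases a rule: cases_up_to_3; cases c rule: cases_up_to_3; simp; presburger)

text \<open>
  The rule for pairs excludes \<open>a + c \<ge> 3\<close> when \<open>a\<close> and \<open>c\<close> are positive, and the rule for triples
  makes \<open>m\<close> even when \<open>a = 0\<close> and \<open>c \<ge> 3\<close>. So \<open>c > 0\<close> implies \<open>a + c \<le> 2\<close>.
\<close>

lemma more_null_centralizers_2_3: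
  assumes "parity_rule 2 2 m a c" "parity_rule 3 3 m a c"
    "admissible m a c" "m + a + c = n" "n \<ge> 4"
  shows "c < m"
  using parity_rule_2D[OF assms(1)] parity_rule_3D[OF assms(2)] assms(3-)[unfolded admissible_def]
  by (cases a rule: cases_up_to_3; cases c rule: cases_up_to_3; simp; presburger)

text \<open>
  Evenness of \<open>m + a\<close> excludes the case \<open>a = 1\<close>, \<open>c = 2\<close> that is problematic in dimension five.
\<close>

lemma more_null_even_centralizer_3:
  assumes "parity_rule 3 3 m a c" "even (m + a)"
    "admissible m a c" "m + a + c = n" "n \<ge> 4"
  shows "c < m"
  using parity_rule_3D[OF assms(1)] assms(2-)[unfolded admissible_def]
  by (cases a rule: cases_up_to_3; cases c rule: cases_up_to_3; simp; presburger)

section \<open>Square-zero complements\<close>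

lemma blade_in_even_Grassmann:
  assumes "A \<subseteq> {p + q + 1..p + q + r}" "even (card A)"
  shows "blade A \<in> (even_Grassmann p q r :: 'f::field mv set)"
proof -
  have "blade A \<in> (Grassmann p q r :: 'f mv set)"
    unfolding Grassmann_eq using assms(1) by (intro mv.span_base) auto
  moreover have "blade A \<in> (even_space p q r :: 'f mv set)"
    unfolding even_space_def using assms by (intro mv.span_base imageI) auto
  ultimately show ?thesis by (simp add: even_Grassmann_def)
qed

lemma gp_eq_zero_if_common_null:
  assumes "\<And>A B. \<lbrakk>A \<subseteq> {1..p + q + r}; B \<subseteq> {1..p + q + r}; X A \<noteq> 0; Y B \<noteq> 0\<rbrakk> \<Longrightarrow>
    A \<inter> B \<inter> {p + q + 1..} \<noteq> {}"
  shows "gp p q r X Y = 0"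
proof -
  have "X A * Y B * blade_coeff p q A B = 0"
    if "A \<subseteq> {1..p + q + r}" "B \<subseteq> {1..p + q + r}" for A B
    using assms[OF that] that(1) blade_coeff_null[of A B p q]
    by (cases "X A = 0 \<or> Y B = 0") (auto intro: finite_subset)
  then show ?thesis
    unfolding gp_def by (intro sum.neutral ballI) (simp add: mv_scale_def fun_eq_iff)
qed

text \<open>
  This reduces the vanishing of all products to arithmetic about a single index set: two index sets
  without a common null index cannot both contain more null indices than they omit.
\<close>

lemma square_zero_perpI:
  fixes H :: "'f::field mv set"
  assumes r: "r \<noteq> 0"
    and rule: "\<And>X A. \<lbrakk>X \<in> H; X A \<noteq> 0; A \<subseteq> {1..p + q + r}\<rbrakk> \<Longrightarrow>
      Q (card (A \<inter> {p + q + 1..})) (card (A - {p + q + 1..})) (card ({1..p + q + r} - A))"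
    and more_null: "\<And>m a c. \<lbrakk>Q m a c; admissible m a c; m + a + c = p + q + r\<rbrakk> \<Longrightarrow> c < m"
  shows "square_zero p q r (perp (even_Grassmann p q r) H)"
  unfolding square_zero_def
proof (intro ballI)
  let ?N = "{1..p + q + r}" and ?M = "{p + q + 1..}"
  fix X Y :: "'f mv"
  assume XY: "X \<in> perp (even_Grassmann p q r) H" "Y \<in> perp (even_Grassmann p q r) H"
  have null: "card (?N - A) < card (A \<inter> ?M)"
    if Z: "Z \<in> perp (even_Grassmann p q r) H" "Z A \<noteq> 0" and A: "A \<subseteq> ?N" for Z A
  proof (rule more_null)
    have fin: "finite A" using A finite_subset by blast
    show "Q (card (A \<inter> ?M)) (card (A - ?M)) (card (?N - A))"
      using rule[of Z A] Z A by (simp add: perp_def)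
    have "card (A \<inter> ?M) + card (A - ?M) = card A"
      using card_Int_Diff[OF fin] by metis
    moreover have "card A + card (?N - A) = p + q + r"
      using card_Diff_subset[OF fin A] card_mono[OF _ A] by simp
    ultimately show "card (A \<inter> ?M) + card (A - ?M) + card (?N - A) = p + q + r" by simp
    have "0 < card (A - ?M) \<or> odd (card (A \<inter> ?M))"
    proof (rule ccontr)
      assume "\<not> (0 < card (A - ?M) \<or> odd (card (A \<inter> ?M)))"
      then have "A - ?M = {}" and even: "even (card (A \<inter> ?M))" using fin by auto
      then have sub: "A \<subseteq> ?M" by blast
      then have "A \<inter> ?M = A" by blast
      with even have "even (card A)" by simp
      moreover have "A \<subseteq> {p + q + 1..p + q + r}"
        using sub A by fastforce
      ultimately have "blade A \<in> (even_Grassmann p q r :: 'f mv set)"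
        by (intro blade_in_even_Grassmann)
      then have "proj (even_Grassmann p q r) Z A = Z A" by (simp add: proj_def)
      then show False using Z by (simp add: perp_def)
    qed
    moreover have "card (?N - A) = 0 \<longrightarrow> 0 < card (A \<inter> ?M)"
    proof
      assume "card (?N - A) = 0"
      then have "p + q + r \<in> A \<inter> ?M" using r by auto
      then show "0 < card (A \<inter> ?M)" using fin by (auto simp: card_gt_0_iff)
    qed
    ultimately show "admissible (card (A \<inter> ?M)) (card (A - ?M)) (card (?N - A))"
      unfolding admissible_def by blast
  qed
  show "gp p q r X Y = 0"
  proof (rule gp_eq_zero_if_common_null, rule notI)
    fix A B assume A: "A \<subseteq> ?N" "X A \<noteq> 0" and B: "B \<subseteq> ?N" "Y B \<noteq> 0" and e: "A \<inter> B \<inter> ?M = {}"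
    have "card (A \<inter> ?M) \<le> card (?N - B)" by (intro card_mono) (use A(1) e in auto)
    moreover have "card (B \<inter> ?M) \<le> card (?N - A)" by (intro card_mono) (use B(1) e in auto)
    ultimately show False
      using null[OF XY(1) A(2,1)] null[OF XY(2) B(2,1)] by linarith
  qed
qed

lemma square_zero_center:
  assumes "r \<noteq> 0"
  shows "square_zero p q r
    (perp (even_Grassmann p q r) (center p q r :: 'f::field_char_0 mv set))"
proof (rule square_zero_perpI[where Q = "parity_rule 1 1", OF assms])
  show "c < m" if "parity_rule 1 1 m a c" "admissible m a c" "m + a + c = p + q + r" for m a c
    using more_null_center[OF that] assms by simp
qed (use centralizer_parity_rule center_subset_centralizer in blast)

lemma square_zero_centralizer_3:
  assumes "r \<noteq> 0" "p + q + r = 4 \<or> p + q + r \<ge> 6"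
  shows "square_zero p q r
    (perp (even_Grassmann p q r) (centralizer p q r 3 :: 'f::field_char_0 mv set))"
  by (rule square_zero_perpI[where Q = "parity_rule 3 3", OF assms(1) centralizer_parity_rule])
    (use assms(2) more_null_centralizer_3 in blast)+

lemma square_zero_twisted_centralizers_2_3:
  assumes "r \<noteq> 0" "p + q + r \<ge> 3"
  shows "square_zero p q r (perp (even_Grassmann p q r)
    (twisted_centralizer p q r 2 \<inter> twisted_centralizer p q r 3 :: 'f::field_char_0 mv set))"
proof (rule square_zero_perpI
    [where Q = "\<lambda>m a c. parity_rule 3 2 m a c \<and> parity_rule 4 3 m a c", OF assms(1)])
  show "c < m" if "parity_rule 3 2 m a c \<and> parity_rule 4 3 m a c" "admissible m a c"
    "m + a + c = p + q + r" for m a c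
    using more_null_twisted_centralizers_2_3 that assms(2) by blast
qed (use twisted_centralizer_parity_rule[of _ p q r 2] twisted_centralizer_parity_rule[of _ p q r 3]
    in auto)

lemma square_zero_twisted_centralizers_1_2:
  assumes "r \<noteq> 0" "p + q + r \<ge> 3"
  shows "square_zero p q r (perp (even_Grassmann p q r)
    (twisted_centralizer p q r 1 \<inter> twisted_centralizer p q r 2 :: 'f::field_char_0 mv set))"
proof (rule square_zero_perpI
    [where Q = "\<lambda>m a c. parity_rule 2 1 m a c \<and> parity_rule 3 2 m a c", OF assms(1)])
  show "c < m" if "parity_rule 2 1 m a c \<and> parity_rule 3 2 m a c" "admissible m a c"
    "m + a + c = p + q + r" for m a c
    using more_null_twisted_centralizers_1_2 that assms(2) by blast
qed (use twisted_centralizer_parity_rule[of _ p q r 1] twisted_centralizer_parity_rule[of _ p q r 2]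
    in \<open>auto simp: numeral_2_eq_2 numeral_3_eq_3\<close>)

lemma square_zero_centralizers_2_3:
  assumes "r \<noteq> 0" "p + q + r \<ge> 4"
  shows "square_zero p q r (perp (even_Grassmann p q r)
    (centralizer p q r 2 \<inter> centralizer p q r 3 :: 'f::field_char_0 mv set))"
proof (rule square_zero_perpI
    [where Q = "\<lambda>m a c. parity_rule 2 2 m a c \<and> parity_rule 3 3 m a c", OF assms(1)])
  show "c < m" if "parity_rule 2 2 m a c \<and> parity_rule 3 3 m a c" "admissible m a c"
    "m + a + c = p + q + r" for m a c
    using more_null_centralizers_2_3 that assms(2) by blast
qed (use centralizer_parity_rule in blast)

lemma square_zero_even_centralizer_3:
  assumes "r \<noteq> 0" "p + q + r \<ge> 4"
  shows "square_zero p q r (perp (even_Grassmann p q r)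
    (centralizer p q r 3 \<inter> even_space p q r :: 'f::field_char_0 mv set))"
proof (rule square_zero_perpI
    [where Q = "\<lambda>m a c. parity_rule 3 3 m a c \<and> even (m + a)", OF assms(1)])
  fix X :: "'f mv" and A
  assume X: "X \<in> centralizer p q r 3 \<inter> even_space p q r" "X A \<noteq> 0" and A: "A \<subseteq> {1..p + q + r}"
  have "card (A \<inter> {p + q + 1..}) + card (A - {p + q + 1..}) = card A"
    using card_Int_Diff[OF finite_subset[OF A], of "{p + q + 1..}"] by simp
  moreover have "even (card A)" using X by (auto simp: even_space_iff)
  ultimately show "parity_rule 3 3 (card (A \<inter> {p + q + 1..})) (card (A - {p + q + 1..}))
      (card ({1..p + q + r} - A)) \<and>
      even (card (A \<inter> {p + q + 1..}) + card (A - {p + q + 1..}))"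
    using centralizer_parity_rule[of X p q r 3 A] X A by auto
next
  show "c < m" if "parity_rule 3 3 m a c \<and> even (m + a)" "admissible m a c"
    "m + a + c = p + q + r" for m a c
    using more_null_even_centralizer_3 that assms(2) by blast
qed

theorem lemma5p7:
  fixes p q r n :: nat
  assumes "p + q + r = n" and "r \<noteq> 0"
  shows
    "((odd n \<longrightarrow>
        square_zero p q r (perp (even_Grassmann p q r) (center p q r :: real mv set))) \<and>
      (n = 4 \<or> n \<ge> 6 \<longrightarrow>
        square_zero p q r (perp (even_Grassmann p q r) (centralizer p q r 3 :: real mv set))) \<and>
      (n \<ge> 3 \<longrightarrow>
        square_zero p q r (perp (even_Grassmann p q r)
          (twisted_centralizer p q r 2 \<inter> twisted_centralizer p q r 3 :: real mv set)) \<and>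
        square_zero p q r (perp (even_Grassmann p q r)
          (twisted_centralizer p q r 1 \<inter> twisted_centralizer p q r 2 :: real mv set))) \<and>
      (n \<ge> 4 \<longrightarrow>
        square_zero p q r (perp (even_Grassmann p q r)
          (centralizer p q r 2 \<inter> centralizer p q r 3 :: real mv set)) \<and>
        square_zero p q r (perp (even_Grassmann p q r)
          (centralizer p q r 3 \<inter> even_space p q r :: real mv set))))
     \<and>
     ((odd n \<longrightarrow>
        square_zero (p + q) 0 r (perp (even_Grassmann (p + q) 0 r)
          (center (p + q) 0 r :: complex mv set))) \<and>
      (n = 4 \<or> n \<ge> 6 \<longrightarrow>
        square_zero (p + q) 0 r (perp (even_Grassmann (p + q) 0 r)
          (centralizer (p + q) 0 r 3 :: complex mv set))) \<and>
      (n \<ge> 3 \<longrightarrow>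
        square_zero (p + q) 0 r (perp (even_Grassmann (p + q) 0 r)
          (twisted_centralizer (p + q) 0 r 2 \<inter> twisted_centralizer (p + q) 0 r 3 :: complex mv set)) \<and>
        square_zero (p + q) 0 r (perp (even_Grassmann (p + q) 0 r)
          (twisted_centralizer (p + q) 0 r 1 \<inter> twisted_centralizer (p + q) 0 r 2 :: complex mv set))) \<and>
      (n \<ge> 4 \<longrightarrow>
        square_zero (p + q) 0 r (perp (even_Grassmann (p + q) 0 r)
          (centralizer (p + q) 0 r 2 \<inter> centralizer (p + q) 0 r 3 :: complex mv set)) \<and>
        square_zero (p + q) 0 r (perp (even_Grassmann (p + q) 0 r)
          (centralizer (p + q) 0 r 3 \<inter> even_space (p + q) 0 r :: complex mv set))))"
  by (intro conjI impI square_zero_center square_zero_centralizer_3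
      square_zero_twisted_centralizers_2_3 square_zero_twisted_centralizers_1_2
      square_zero_centralizers_2_3 square_zero_even_centralizer_3)
    (use assms in auto)

end
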